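(* Let $H\in\mathbb{C}^{N\times N}$ be Hermitian with eigenvalues $E_0\le E_1\le\dots\le E_{N-1}$, and let $z_k=a_k+ib_k$ with $a_k\in\mathbb{R}$ and $b_k>0$. For any tolerance $\epsilon>0$, the resolvent $R(z_k)=(z_k-H)^{-1}$ admits a real-time LCU construction $\mathcal{I}_J(z_k)$ with $\lVert R(z_k)-\mathcal{I}_J(z_k)\rVert_2<\epsilon$. Specifically, the Gauss--Legendre rule defines a time grid $\boldsymbol{t}=(t_0,\dots,t_{J-1})$ such that $$J=\log_2\log\frac{2}{\epsilon b_k}+(\eta_k+1)\log_2\frac{2}{\epsilon b_k}+3$$ distinct time-evolution circuits suffice to construct $\mathcal{I}_J(z_k)$, where $$\eta_k=\frac{3b_k-2\sqrt{2}\,b_k+a_k^{+}}{4\sqrt{2}\,b_k},\qquad a_k^{+}=\max_{0\le n\le N-1}|a_k-E_n|.$$ The corresponding maximal and total evolution times are $$T^{\max}=\lVert\boldsymbol{t}\rVert_\infty=\frac{1}{b_k}\log\frac{2}{\epsilon b_k},\qquad T^{\rm tot}=\lVert\boldsymbol{t}\rVert_1=\frac{J}{2b_k}\log\frac{2}{\epsilon b_k}.$$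
   Context: $\lVert\cdot\rVert_2$ is the operator (spectral) norm; $\log$ is the natural logarithm. For $b_k>0$ the resolvent has the integral representation $R(z_k)=-i\int_0^\infty e^{-b_kq}e^{i(a_k-H)q}\,dq$. A real-time LCU construction of an operator is an approximation of the form $\sum_{j=0}^{J-1}x_je^{-iHt_j}$ with scalar coefficients $x_j\in\mathbb{C}$ and evolution times $t_j\in\mathbb{R}$; the vector $\boldsymbol{t}=(t_0,\dots,t_{J-1})$ is the time grid, $\lVert\boldsymbol{t}\rVert_\infty=\max_j|t_j|$ and $\lVert\boldsymbol{t}\rVert_1=\sum_j|t_j|$. The Gauss--Legendre construction with truncation time $T>0$ and $J$ nodes is: let $s_0,\dots,s_{J-1}\in[-1,1]$ be the roots of the degree-$J$ Legendre polynomial with Gauss--Legendre weights $w_0,\dots,w_{J-1}$ (so that $\sum_j w_jp(s_j)=\int_{-1}^1p(s)ds$ for all polynomials $p$ of degree $\le 2J-1$), set $t_j=T(1+s_j)/2$ and $\mathcal{I}_J(z_k)=-i\frac{T}{2}\sum_{j=0}^{J-1}w_j e^{(ia_k-b_k)t_j}e^{-iHt_j}$, which discretizes the truncated integral $-i\int_0^{T}e^{-b_kq}e^{i(a_k-H)q}dq$.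
   Formalization: Assumes εb_k<2 (otherwise log log(2/(εb_k)) is undefined); J is the formula rounded up to an integer; the maximal time is stated as ‖t‖_∞ ≤ (1/b_k)log(2/(εb_k)), since Gauss–Legendre nodes are interior and equality is false. *)

theory Defs
  imports "HOL-Analysis.Analysis" "HOL-Computational_Algebra.Polynomial"
begin

definition hermitian :: "complex^'n^'n \<Rightarrow> bool" where
  "hermitian A \<longleftrightarrow> (\<forall>i j. A$i$j = cnj (A$j$i))"

definition mat_eigenvalue :: "complex^'n^'n \<Rightarrow> complex \<Rightarrow> bool" where
  "mat_eigenvalue A l \<longleftrightarrow> (\<exists>v. v \<noteq> 0 \<and> A *v v = l *s v)"

definition cscale :: "complex \<Rightarrow> complex^'n^'n \<Rightarrow> complex^'n^'n" where
  "cscale c A = (\<chi> i j. c * A$i$j)"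

fun mpow :: "complex^'n^'n \<Rightarrow> nat \<Rightarrow> complex^'n^'n" where
  "mpow A 0 = mat 1"
| "mpow A (Suc k) = A ** mpow A k"

definition mexp :: "complex^'n^'n \<Rightarrow> complex^'n^'n" where
  "mexp A = (\<Sum>k. (1 / fact k) *\<^sub>R mpow A k)"

definition opnorm2 :: "complex^'n^'n \<Rightarrow> real" where
  "opnorm2 A = onorm (\<lambda>x. A *v x)"

text \<open>Legendre polynomials via Bonnet's recurrence:
  P_0 = 1, P_1 = x, (n+2) P_(n+2) = (2n+3) x P_(n+1) - (n+1) P_n.\<close>
fun legendre :: "nat \<Rightarrow> real poly" where
  "legendre 0 = 1"
| "legendre (Suc 0) = [:0, 1:]"
| "legendre (Suc (Suc n)) =
     smult (1 / real (n + 2))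
       (smult (real (2 * n + 3)) ([:0, 1:] * legendre (Suc n)) - smult (real (n + 1)) (legendre n))"

definition gauss_legendre :: "nat \<Rightarrow> (nat \<Rightarrow> real) \<Rightarrow> (nat \<Rightarrow> real) \<Rightarrow> bool" where
  "gauss_legendre J s w \<longleftrightarrow>
     inj_on s {..<J} \<and>
     s ` {..<J} = {x. poly (legendre J) x = 0} \<and>
     (\<forall>j<J. s j \<in> {-1..1}) \<and>
     (\<forall>p::real poly. degree p < 2 * J \<longrightarrow>
        (\<Sum>j<J. w j * poly p (s j)) = integral {-1..1} (\<lambda>x. poly p x))"

definition GL_time :: "real \<Rightarrow> (nat \<Rightarrow> real) \<Rightarrow> nat \<Rightarrow> real" where
  "GL_time T s j = T * (1 + s j) / 2"

definition GL_LCU :: "complex^'n^'n \<Rightarrow> real \<Rightarrow> real \<Rightarrow> real \<Rightarrow> nat \<Rightarrow> (nat \<Rightarrow> real) \<Rightarrow> (nat \<Rightarrow> real)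
    \<Rightarrow> complex^'n^'n" where
  "GL_LCU H a b T J s w =
     cscale (- \<i> * complex_of_real (T / 2))
       (\<Sum>j<J. cscale (complex_of_real (w j) * exp ((\<i> * a - b) * GL_time T s j))
                 (mexp (cscale (- \<i> * GL_time T s j) H)))"

definition resolvent :: "complex^'n^'n \<Rightarrow> complex \<Rightarrow> complex^'n^'n" where
  "resolvent H z = matrix_inv (mat z - H)"

end

theory Submission
  imports Defs "HOL-Complex_Analysis.Complex_Analysis"
begin

text \<open>Since \<open>H\<close> is Hermitian, the norm of \<open>R(z) - I\<^sub>J(z)\<close> is governed by its scalar value at each
  eigenvalue \<open>E\<close>. With \<open>c = \<i>(a - E) - b\<close> that value is the sum of a truncation error of modulus
  \<open>e\<^bsup>-bT\<^esup> / |c| \<le> \<epsilon>/2\<close> and \<open>T/2\<close> times the Gauss--Legendre error of \<open>f(x) = e\<^bsup>\<kappa>(1 + x)\<^esup>\<close> on \<open>[-1,1]\<close>,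
  where \<open>\<kappa> = cT/2\<close>.

  On the Bernstein ellipse \<open>{(u + 1/u)/2. |u| = \<rho>}\<close> with \<open>\<rho> = \<surd>2\<close> one has \<open>|f| \<le> M = L\<^bsup>\<eta>\<^esup>\<close>, which is where
  the constants in \<open>\<eta>\<close> come from. The Chebyshev coefficients of \<open>f\<close> are therefore at most
  \<open>2 M \<rho>\<^bsup>-k\<^esup>\<close>. The rule is exact on \<open>T\<^sub>k\<close> for \<open>k < 2J\<close> and, by symmetry, for odd \<open>k\<close>;
  for the other \<open>k\<close> the error is at most \<open>2 + 4/3\<close>. Summing over even \<open>k \<ge> 2J\<close> gives
  \<open>(40/3) M 2\<^bsup>-J\<^esup>\<close>, and the choice of \<open>J\<close> makes \<open>T/2\<close> times this at most \<open>(5/6) \<epsilon>/2\<close>.\<close>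

section \<open>Self-adjoint maps\<close>

text \<open>Variational argument: a maximiser \<open>x\<close> of the Rayleigh quotient on the unit
  sphere of \<open>S\<close> is an eigenvector, because a nonzero residual \<open>r\<close> would
  give a direction inside \<open>S\<close> in which the maximum is exceeded.\<close>

lemma self_adjoint_eigenvector_in_subspace:
  fixes f :: "'a::euclidean_space \<Rightarrow> 'a"
  assumes "linear f" and sym: "\<And>x y. f x \<bullet> y = x \<bullet> f y"
    and "subspace S" and inv: "f ` S \<subseteq> S" and "S \<noteq> {0}"
  obtains x l where "x \<in> S" "x \<noteq> 0" "f x = l *\<^sub>R x"
proof -
  interpret linear f by fact
  have contf: "continuous_on A f" for A
    using \<open>linear f\<close> linear_continuous_on linear_conv_bounded_linear by blast
  obtain v where v: "v \<in> S" "v \<noteq> 0"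
    using \<open>S \<noteq> {0}\<close> subspace_0[OF \<open>subspace S\<close>] by auto
  have "compact (S \<inter> sphere 0 1)"
    using closed_subspace[OF \<open>subspace S\<close>] by (intro closed_Int_compact compact_sphere)
  moreover have "v /\<^sub>R norm v \<in> S \<inter> sphere 0 1"
    using v \<open>subspace S\<close> by (auto simp: subspace_scale)
  moreover have "continuous_on (S \<inter> sphere 0 1) (\<lambda>x. x \<bullet> f x)"
    by (intro continuous_intros contf)
  ultimately obtain x where x: "x \<in> S \<inter> sphere 0 1"
    and max: "\<And>y. y \<in> S \<inter> sphere 0 1 \<Longrightarrow> y \<bullet> f y \<le> x \<bullet> f x"
    using continuous_attains_sup[of "S \<inter> sphere 0 1" "\<lambda>x. x \<bullet> f x"] by blast
  define m where "m = x \<bullet> f x"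
  have q: "y \<bullet> f y \<le> m * (y \<bullet> y)" if "y \<in> S" for y
  proof (cases "y = 0")
    case False
    have "(y /\<^sub>R norm y) \<bullet> f (y /\<^sub>R norm y) \<le> m"
      unfolding m_def using that False \<open>subspace S\<close> by (intro max) (auto simp: subspace_scale)
    then have "(y \<bullet> f y) / (norm y)\<^sup>2 \<le> m"
      by (simp add: scale power2_eq_square divide_simps)
    then show ?thesis
      using False by (simp add: dot_square_norm divide_simps split: if_splits)
  qed (simp add: zero)
  define r where "r = m *\<^sub>R x - f x"
  have xx: "x \<bullet> x = 1" "x \<in> S"
    using x by (auto simp: dot_square_norm)
  have rS: "r \<in> S"
    using xx inv \<open>subspace S\<close> by (auto simp: r_def intro!: subspace_diff subspace_scale)
  \<comment> \<open>This is \<open>q\<close> at the perturbed point \<open>x + t r\<close>. For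
    small negative \<open>t\<close> the linear term dominates, so it must vanish.\<close>
  have "0 \<le> 2 * t * (r \<bullet> r) + t\<^sup>2 * (m * (r \<bullet> r) - r \<bullet> f r)" for t
  proof -
    have "(x + t *\<^sub>R r) \<bullet> f (x + t *\<^sub>R r) \<le> m * ((x + t *\<^sub>R r) \<bullet> (x + t *\<^sub>R r))"
      using xx rS \<open>subspace S\<close> by (intro q) (auto intro!: subspace_add subspace_scale)
    also have "(x + t *\<^sub>R r) \<bullet> f (x + t *\<^sub>R r) = m + 2 * t * (r \<bullet> f x) + t\<^sup>2 * (r \<bullet> f r)"
      using sym[of x r] by (simp add: add scale inner_simps m_def power2_eq_square inner_commute algebra_simps)
    also have "m * ((x + t *\<^sub>R r) \<bullet> (x + t *\<^sub>R r)) = m + 2 * t * (r \<bullet> (m *\<^sub>R x)) + t\<^sup>2 * (m * (r \<bullet> r))"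
      using xx by (simp add: inner_simps power2_eq_square inner_commute algebra_simps)
    finally have "0 \<le> 2 * t * (r \<bullet> (m *\<^sub>R x) - r \<bullet> f x) + t\<^sup>2 * (m * (r \<bullet> r) - r \<bullet> f r)"
      by (simp add: algebra_simps)
    also have "r \<bullet> (m *\<^sub>R x) - r \<bullet> f x = r \<bullet> r"
      by (simp add: r_def inner_diff_right)
    finally show ?thesis .
  qed
  moreover define c where "c = m * (r \<bullet> r) - r \<bullet> f r"
  ultimately have A: "0 \<le> 2 * t * (r \<bullet> r) + t\<^sup>2 * c" for t by auto
  have "r \<bullet> r \<le> 0"
  proof (rule ccontr)
    assume "\<not> r \<bullet> r \<le> 0"
    then have pos: "r \<bullet> r > 0" by linarith
    have c0: "c \<ge> 0" using q[OF rS] by (simp add: c_def)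
    \<comment> \<open>The denominator \<open>c + 1\<close> instead of \<open>c\<close> also covers
      \<open>c = 0\<close>.\<close>
    define t where "t = - (r \<bullet> r) / (c + 1)"
    have "2 * t * (r \<bullet> r) + t\<^sup>2 * c = - (r \<bullet> r)\<^sup>2 * (c + 2) / (c + 1)\<^sup>2"
      using c0 unfolding t_def by (simp add: divide_simps power2_eq_square) (simp add: algebra_simps)
    also have "\<dots> < 0"
      using pos c0 by (simp add: divide_simps mult_neg_pos)
    finally show False using A[of t] by simp
  qed
  then have "r = 0"
    by (metis inner_eq_zero_iff inner_ge_zero order_antisym)
  then show ?thesis
    using that[of x m] xx unfolding r_def by (metis eq_iff_diff_eq_0 inner_zero_left zero_neq_one)
qed

text \<open>Otherwise the orthogonal complement of all eigenvectors is a nonzero invariant subspace.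
  It then contains an eigenvector, which is orthogonal to itself.\<close>

lemma self_adjoint_span_eigenvectors:
  fixes f :: "'a::euclidean_space \<Rightarrow> 'a"
  assumes "linear f" and sym: "\<And>x y. f x \<bullet> y = x \<bullet> f y"
  shows "span {x. \<exists>l. f x = l *\<^sub>R x} = UNIV"
proof (rule ccontr)
  let ?E = "{x. \<exists>l. f x = l *\<^sub>R x}"
  define S where "S = {x. \<forall>y\<in>?E. orthogonal y x}"
  assume "span ?E \<noteq> UNIV"
  then obtain a where "a \<noteq> 0" "\<forall>x\<in>span ?E. a \<bullet> x = 0"
    using span_not_UNIV_orthogonal by blast
  then have "a \<in> S"
    unfolding S_def orthogonal_def by (simp add: span_base inner_commute[of _ a])
  have "subspace S"
    unfolding S_def by (simp add: subspace_def orthogonal_clauses)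
  moreover have "f ` S \<subseteq> S"
  proof clarify
    fix z assume "z \<in> S"
    have "y \<bullet> f z = 0" if "f y = l *\<^sub>R y" for y l
      using \<open>z \<in> S\<close> that sym[of y z] by (auto simp: S_def orthogonal_def)
    then show "f z \<in> S" by (auto simp: S_def orthogonal_def)
  qed
  ultimately obtain x l where x: "x \<in> S" "x \<noteq> 0" "f x = l *\<^sub>R x"
    using self_adjoint_eigenvector_in_subspace[OF assms, of S] \<open>a \<in> S\<close> \<open>a \<noteq> 0\<close> by blast
  then have "orthogonal x x" unfolding S_def by blast
  with x show False by (simp add: orthogonal_def)
qed

lemma self_adjoint_eigenvectors_orthogonal:
  fixes f :: "'a::real_inner \<Rightarrow> 'a"
  assumes sym: "\<And>x y. f x \<bullet> y = x \<bullet> f y"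
    and "f x = k *\<^sub>R x" "f y = l *\<^sub>R y" "k \<noteq> l"
  shows "orthogonal x y"
  using sym[of x y] assms(2-) by (simp add: orthogonal_def)

text \<open>Collecting eigenvectors by eigenvalue leaves one component per \<open>l\<close>, so
  distinct components are orthogonal and Pythagoras applies later. The value \<open>v l = 0\<close>
  is allowed.\<close>

lemma self_adjoint_eigenvector_decomposition:
  fixes f :: "'a::euclidean_space \<Rightarrow> 'a"
  assumes "linear f" and sym: "\<And>x y. f x \<bullet> y = x \<bullet> f y"
  obtains A v where "finite A" "x = (\<Sum>l\<in>A. v l)" "\<And>l. f (v l) = l *\<^sub>R v l"
proof -
  interpret linear f by fact
  let ?D = "\<lambda>x. \<exists>A v. finite A \<and> x = (\<Sum>l\<in>A. v l) \<and> (\<forall>l. f (v l) = l *\<^sub>R v l)"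
  have "x \<in> span {x. \<exists>l. f x = l *\<^sub>R x}"
    using self_adjoint_span_eigenvectors[OF assms] by simp
  then have "?D x"
  proof (induction rule: span_induct_alt)
    case base
    show ?case by (rule exI[of _ "{}"], rule exI[of _ "\<lambda>_. 0"]) (simp add: zero)
  next
    case (step c y z)
    then obtain k where k: "f y = k *\<^sub>R y" by blast
    from step obtain A v where v: "finite A" "z = (\<Sum>l\<in>A. v l)" "\<And>l. f (v l) = l *\<^sub>R v l" by blast
    define w where "w = (\<lambda>l. (if l = k then c *\<^sub>R y else 0) + (if l \<in> A then v l else 0))"
    have "(\<Sum>l\<in>insert k A. w l) = c *\<^sub>R y + z"
      using v(1,2) by (simp add: w_def sum.distrib) (auto simp: insert_absorb sum.If_cases Int_absorb1 intro: sum.cong)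
    moreover have "f (w l) = l *\<^sub>R w l" for l
      using k v(3) by (auto simp: w_def add scale zero scaleR_add_right)
    ultimately show ?case using v(1) by (metis finite_insert)
  qed
  then show ?thesis using that by blast
qed

section \<open>Functional calculus of Hermitian matrices\<close>

lemma cscale_mult_vec: "cscale c A *v x = c *s (A *v x)"
  by (simp add: vec_eq_iff cscale_def matrix_vector_mult_def sum_distrib_left mult.assoc)

lemma scaleR_eq_vector_smult: "c *\<^sub>R x = complex_of_real c *s (x :: complex^'n)"
  by (simp add: vec_eq_iff scaleR_conv_of_real[where 'a=complex])

lemma scaleR_mult_vec: "(c *\<^sub>R A) *v x = c *\<^sub>R (A *v x)" for A :: "complex^'n^'m"
  by (simp add: vec_eq_iff matrix_vector_mult_def scaleR_right.sum)

lemma matrix_vector_mult_smult: "A *v (c *s x) = c *s (A *v x)" for A :: "complex^'n^'m"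
  by (simp add: vector_scalar_commute)

lemma norm_vector_smult: "norm (c *s x) = cmod c * norm x" for x :: "complex^'n"
  by (simp add: norm_vec_def norm_mult L2_set_right_distrib)

lemma sum_matrix_vector_mult: "(\<Sum>i\<in>I. A i) *v x = (\<Sum>i\<in>I. A i *v x)"
  by (induction I rule: infinite_finite_induct) (auto simp: matrix_vector_mult_add_rdistrib)

text \<open>The inner product of \<open>complex^'n\<close> as a Euclidean space is the real part of
  the Hermitian one, so the real theory of self-adjoint maps becomes available for
  \<open>H\<close>.\<close>

lemma hermitian_inner:
  assumes "hermitian H"
  shows "(H *v x) \<bullet> y = x \<bullet> (H *v y)"
proof -
  have "(\<Sum>i\<in>UNIV. (H *v x)$i * cnj (y$i)) = (\<Sum>i\<in>UNIV. \<Sum>j\<in>UNIV. H$i$j * x$j * cnj (y$i))"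
    by (simp add: matrix_vector_mult_def sum_distrib_right)
  also have "\<dots> = (\<Sum>j\<in>UNIV. \<Sum>i\<in>UNIV. H$i$j * x$j * cnj (y$i))"
    by (rule sum.swap)
  also have "\<dots> = (\<Sum>j\<in>UNIV. \<Sum>i\<in>UNIV. x$j * (cnj (H$j$i) * cnj (y$i)))"
  proof (intro sum.cong refl)
    fix i j
    have "H$i$j = cnj (H$j$i)" using assms unfolding hermitian_def by blast
    then show "H$i$j * x$j * cnj (y$i) = x$j * (cnj (H$j$i) * cnj (y$i))"
      by (metis mult.assoc mult.commute)
  qed
  also have "\<dots> = (\<Sum>j\<in>UNIV. x$j * cnj ((H *v y)$j))"
    by (simp add: matrix_vector_mult_def sum_distrib_left)
  finally have "Re (\<Sum>i\<in>UNIV. (H *v x)$i * cnj (y$i)) = Re (\<Sum>j\<in>UNIV. x$j * cnj ((H *v y)$j))"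
    by (rule arg_cong)
  then show ?thesis
    by (simp add: inner_vec_def inner_complex_def)
qed

text \<open>In the real inner product \<open>v\<close> is orthogonal to \<i> times \<open>v\<close>.
  Testing the symmetry of \<open>H\<close> on this pair yields \<open>Im l\<close> times the squared
  norm of \<open>v\<close> on one side and its negative on the other.\<close>

lemma hermitian_eigenvalue_real:
  assumes "hermitian H" "mat_eigenvalue H l"
  shows "Im l = 0"
proof -
  obtain v where v: "v \<noteq> 0" "H *v v = l *s v"
    using assms by (auto simp: mat_eigenvalue_def)
  have orth: "x \<bullet> (\<i> *s x) = 0" for x :: "complex^'n"
    by (simp add: inner_vec_def inner_complex_def)
  have "(H *v v) \<bullet> (\<i> *s v) = v \<bullet> (\<i> *s (H *v v))"
    using hermitian_inner[OF assms(1)] by (simp add: matrix_vector_mult_smult)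
  moreover have "H *v v = Re l *\<^sub>R v + Im l *\<^sub>R (\<i> *s v)"
    by (simp add: v(2) vec_eq_iff complex_eq_iff)
  ultimately have "(Re l *\<^sub>R v + Im l *\<^sub>R (\<i> *s v)) \<bullet> (\<i> *s v) = v \<bullet> (\<i> *s (Re l *\<^sub>R v + Im l *\<^sub>R (\<i> *s v)))"
    by (simp only:)
  moreover have "\<i> *s (Re l *\<^sub>R v + Im l *\<^sub>R (\<i> *s v)) = Re l *\<^sub>R (\<i> *s v) - Im l *\<^sub>R v"
    by (simp add: vec_eq_iff complex_eq_iff)
  moreover have "(\<i> *s v) \<bullet> (\<i> *s v) = v \<bullet> v"
    by (simp add: dot_square_norm norm_vector_smult)
  ultimately have "2 * Im l * (v \<bullet> v) = 0"
    by (simp add: inner_add_left inner_diff_right orth)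
  then show ?thesis using v by simp
qed

text \<open>Choosing one eigenvector per eigenvalue gives an orthogonal family of nonzero vectors.
  Finiteness gives meaning to the \<open>Max\<close> in the theorem.\<close>

lemma hermitian_finite_eigenvalues:
  assumes "hermitian H"
  shows "finite {l. mat_eigenvalue H l}"
proof -
  let ?E = "{l. mat_eigenvalue H l}"
  have "\<forall>l\<in>?E. \<exists>v. v \<noteq> 0 \<and> H *v v = l *s v"
    by (auto simp: mat_eigenvalue_def)
  then obtain v where v: "\<And>l. l \<in> ?E \<Longrightarrow> v l \<noteq> 0 \<and> H *v v l = l *s v l"
    by metis
  have R: "complex_of_real (Re l) = l" if "l \<in> ?E" for l
    using hermitian_eigenvalue_real[OF assms] that by (simp add: complex_eq_iff)
  have "orthogonal (v k) (v l)" if "k \<in> ?E" "l \<in> ?E" "k \<noteq> l" for k l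
  proof (rule self_adjoint_eigenvectors_orthogonal[where f="(*v) H"])
    show "H *v v k = Re k *\<^sub>R v k" "H *v v l = Re l *\<^sub>R v l"
      using v that R by (simp_all add: scaleR_eq_vector_smult)
    show "Re k \<noteq> Re l" using R that by metis
  qed (rule hermitian_inner[OF assms])
  then have *: "pairwise (\<lambda>k l. orthogonal (v k) (v l)) ?E"
    by (simp add: pairwise_def)
  have "inj_on v ?E"
    using * v by (auto simp: inj_on_def pairwise_def orthogonal_def) (metis inner_eq_zero_iff)
  moreover have "finite (v ` ?E)"
    using * by (intro pairwise_orthogonal_imp_finite) (auto simp: pairwise_def)
  ultimately show ?thesis by (rule finite_imageD[rotated])
qed

lemma hermitian_decomposition:
  assumes "hermitian H"
  obtains A v where "finite A" "x = (\<Sum>l\<in>A. v l)" "\<And>l. H *v v l = of_real l *s v l"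
    "\<And>l. l \<in> A \<Longrightarrow> mat_eigenvalue H (of_real l)"
proof -
  have "linear ((*v) H)" by (rule matrix_vector_mul_linear)
  then obtain A v where v: "finite A" "x = (\<Sum>l\<in>A. v l)" "\<And>l. H *v v l = l *\<^sub>R v l"
    using self_adjoint_eigenvector_decomposition[of "(*v) H" x] hermitian_inner[OF assms] by metis
  show ?thesis
  \<comment> \<open>Zero components are dropped so that every remaining index is an
    eigenvalue.\<close>
  proof (rule that[of "{l\<in>A. v l \<noteq> 0}" v])
    show "x = (\<Sum>l | l \<in> A \<and> v l \<noteq> 0. v l)"
      unfolding v(2) using v(1) by (intro sum.mono_neutral_right) auto
  qed (use v in \<open>auto simp: mat_eigenvalue_def scaleR_eq_vector_smult\<close>)
qed

text \<open>A matrix \<open>B\<close> acting on each eigenspace of \<open>H\<close> as a scalar \<open>F l\<close> is \<open>F(H)\<close>.\<close>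

lemma opnorm2_function_of_hermitian:
  assumes H: "hermitian H"
    and F: "\<And>l x. mat_eigenvalue H (complex_of_real l) \<Longrightarrow> H *v x = of_real l *s x \<Longrightarrow> B *v x = F l *s x"
    and K: "\<And>l. mat_eigenvalue H (complex_of_real l) \<Longrightarrow> cmod (F l) \<le> K" and "K \<ge> 0"
  shows "opnorm2 B \<le> K"
  unfolding opnorm2_def
proof (rule onorm_le)
  fix x
  obtain A v where v: "finite A" "x = (\<Sum>l\<in>A. v l)" "\<And>l. H *v v l = of_real l *s v l"
    and ev: "\<And>l. l \<in> A \<Longrightarrow> mat_eigenvalue H (of_real l)"
    using hermitian_decomposition[OF H] by metis
  \<comment> \<open>Arbitrary factors \<open>c\<close> let one statement serve both for
    \<open>B *v x\<close> (with \<open>c = F\<close>) and for \<open>x\<close> itself (with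
    \<open>c = 1\<close>).\<close>
  have orth: "pairwise (\<lambda>k l. orthogonal (c k *s v k) (c l *s v l)) A" for c
    unfolding pairwise_def
  proof clarify
    fix k l :: real assume "k \<noteq> l"
    have "H *v (c j *s v j) = j *\<^sub>R (c j *s v j)" for j
      unfolding matrix_vector_mult_smult v(3) by (simp add: vec_eq_iff scaleR_conv_of_real[where 'a=complex])
    then show "orthogonal (c k *s v k) (c l *s v l)"
      using self_adjoint_eigenvectors_orthogonal[where f="(*v) H", OF hermitian_inner[OF H]] \<open>k \<noteq> l\<close> by blast
  qed
  have "B *v x = (\<Sum>l\<in>A. B *v v l)"
    unfolding v(2) by (rule linear_sum[OF matrix_vector_mul_linear])
  also have "\<dots> = (\<Sum>l\<in>A. F l *s v l)"
    using F[OF ev v(3)] by (rule sum.cong[OF refl])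
  finally have "(norm (B *v x))\<^sup>2 = (\<Sum>l\<in>A. (norm (F l *s v l))\<^sup>2)"
    by (simp only: norm_sum_Pythagorean[OF v(1) orth])
  also have "\<dots> \<le> (\<Sum>l\<in>A. K\<^sup>2 * (norm (v l))\<^sup>2)"
    using K[OF ev] by (intro sum_mono) (simp add: norm_vector_smult power_mult_distrib mult_right_mono power_mono)
  also have "\<dots> = (K * norm x)\<^sup>2"
    using norm_sum_Pythagorean[OF v(1) orth[of "\<lambda>_. 1"]]
    unfolding v(2) by (simp add: power_mult_distrib sum_distrib_left)
  finally show "norm (B *v x) \<le> K * norm x"
    by (rule power2_le_imp_le) (simp add: \<open>K \<ge> 0\<close>)
qed

lemma mpow_eigenvector:
  assumes "A *v x = l *s x"
  shows "mpow A k *v x = l ^ k *s x"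
  by (induction k) (simp_all add: assms matrix_vector_mul_assoc[symmetric] matrix_vector_mult_smult vector_smult_assoc mult.commute)

text \<open>Applying the matrices to \<open>axis j 1\<close> reads off their columns, so convergence
  on vectors forces convergence of every entry. This is how the \<open>suminf\<close> in
  \<open>mexp\<close> is shown to be a genuine limit.\<close>

lemma sums_matrix_of_sums_mult_vec:
  fixes A :: "nat \<Rightarrow> complex^'n^'m"
  assumes "\<And>x. summable (\<lambda>k. A k *v x)"
  shows "summable A" and "(\<lambda>k. A k *v x) sums (suminf A *v x)"
proof -
  have col: "(A k *v axis j 1) $ i = A k $ i $ j" for k i j
    by (simp add: matrix_vector_mult_def axis_def if_distrib cong: if_cong)
  define S where "S = (\<chi> i j. \<Sum>k. A k $ i $ j)"
  have entry: "(\<lambda>k. A k $ i $ j) sums (S $ i $ j)" for i j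
  proof -
    have "summable (\<lambda>k. (A k *v axis j 1) $ i)"
      using bounded_linear.summable[OF bounded_linear_vec_nth assms] .
    then show ?thesis by (simp add: col S_def summable_sums)
  qed
  have S: "A sums S"
    using entry unfolding sums_def by (intro vec_tendstoI) (simp only: sum_component)
  then show "summable A" by (rule sums_summable)
  have "bounded_linear (\<lambda>M::complex^'n^'m. M *v x)"
    by (intro linear_conv_bounded_linear[THEN iffD1] linearI)
       (simp_all add: matrix_vector_mult_add_rdistrib scaleR_mult_vec)
  then show "(\<lambda>k. A k *v x) sums (suminf A *v x)"
    using bounded_linear.sums[OF _ S] by (simp only: sums_unique[OF S, symmetric])
qed

lemma mexp_eigenvector:
  assumes H: "hermitian H" and x: "H *v x = of_real l *s x"
  shows "mexp (cscale c H) *v x = exp (c * of_real l) *s x"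
proof -
  let ?A = "\<lambda>k. (1 / fact k) *\<^sub>R mpow (cscale c H) k"
  have A: "(\<lambda>k. ?A k *v x) sums (exp (c * of_real l) *s x)"
    if "H *v x = of_real l *s x" for x and l :: real
  proof -
    have "cscale c H *v x = (c * of_real l) *s x"
      by (simp add: that cscale_mult_vec vector_smult_assoc)
    then have "mpow (cscale c H) k *v x = (c * of_real l) ^ k *s x" for k
      by (rule mpow_eigenvector)
    then have eq: "?A k *v x = ((c * of_real l) ^ k /\<^sub>R fact k) *s x" for k
      unfolding scaleR_mult_vec \<open>mpow (cscale c H) k *v x = _\<close>
      by (simp add: vec_eq_iff divide_inverse)
    have "bounded_linear (\<lambda>z. z *s x)"
      by (intro linear_conv_bounded_linear[THEN iffD1] linearI)
         (simp_all add: vec_eq_iff algebra_simps)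
    from bounded_linear.sums[OF this exp_converges[of "c * of_real l"]] show ?thesis
      unfolding eq by simp
  qed
  \<comment> \<open>Summability of the matrix series needs every vector, not only the given
    eigenvector; \<open>y\<close> is split into eigenvectors.\<close>
  have "summable (\<lambda>k. ?A k *v y)" for y
  proof -
    obtain L v where v: "finite L" "y = (\<Sum>l\<in>L. v l)" "\<And>l. H *v v l = of_real l *s v l"
      using hermitian_decomposition[OF H] by metis
    have "?A k *v y = (\<Sum>l\<in>L. ?A k *v v l)" for k
      using linear_sum[OF matrix_vector_mul_linear] v(2) by blast
    then show ?thesis
      using A[OF v(3)] by (simp only:) (intro summable_sum, auto dest: sums_summable)
  qed
  from sums_matrix_of_sums_mult_vec(2)[OF this, of x] A[OF x] show ?thesis
    unfolding mexp_def by (rule sums_unique2)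
qed

lemma resolvent_eigenvector:
  assumes H: "hermitian H" and "Im z \<noteq> 0" and x: "H *v x = of_real l *s x"
  shows "resolvent H z *v x = (1 / (z - of_real l)) *s x"
proof -
  let ?A = "mat z - H"
  have A: "?A *v y = z *s y - H *v y" for y
  proof -
    have "mat z *v y = z *s y"
      by (simp add: vec_eq_iff matrix_vector_mult_def mat_def if_distrib if_distribR cong: if_cong)
    then show ?thesis by (simp add: matrix_vector_mult_diff_rdistrib)
  qed
  \<comment> \<open>A nonzero kernel vector would make the non-real \<open>z\<close> an eigenvalue
    of \<open>H\<close>.\<close>
  have "y = 0" if "?A *v y = 0" for y
    using that hermitian_eigenvalue_real[OF H, of z] \<open>Im z \<noteq> 0\<close> by (force simp: A mat_eigenvalue_def)
  then have "invertible ?A"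
    by (simp add: invertible_left_inverse matrix_left_invertible_ker)
  then have inv: "matrix_inv ?A ** ?A = mat 1"
    unfolding invertible_def matrix_inv_def by (rule someI2_ex) simp
  have "z - of_real l \<noteq> 0" using \<open>Im z \<noteq> 0\<close> by (auto simp: complex_eq_iff)
  moreover have "?A *v x = (z - of_real l) *s x"
    by (simp add: A x vector_sub_rdistrib)
  ultimately have "x = ?A *v ((1 / (z - of_real l)) *s x)"
    by (simp only: matrix_vector_mult_smult vector_smult_assoc) simp
  then have "resolvent H z *v x = (matrix_inv ?A ** ?A) *v ((1 / (z - of_real l)) *s x)"
    unfolding resolvent_def by (simp add: matrix_vector_mul_assoc[symmetric])
  then show ?thesis by (simp add: inv)
qed

section \<open>Chebyshev expansions of polynomials\<close>

text \<open>First kind, with complex coefficients so that evaluation on ellipses around [-1,1] is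
  possible.\<close>

fun cheb :: "nat \<Rightarrow> complex poly" where
  "cheb 0 = 1"
| "cheb (Suc 0) = [:0, 1:]"
| "cheb (Suc (Suc n)) = [:0, 2:] * cheb (Suc n) - cheb n"

text \<open>Second kind: these arise as derivatives of \<open>cheb\<close> and lead to an
  antiderivative of \<open>cheb k\<close>.\<close>

fun chebU :: "nat \<Rightarrow> complex poly" where
  "chebU 0 = 1"
| "chebU (Suc 0) = [:0, 2:]"
| "chebU (Suc (Suc n)) = [:0, 2:] * chebU (Suc n) - chebU n"

text \<open>The powers of \<open>u\<close> and of \<open>1 / u\<close> both satisfy the Chebyshev
  recurrence with multiplier \<open>u + 1 / u\<close>. The case |u| = 1 is the cosine formula on
  [-1,1], and other radii parametrise Bernstein ellipses.\<close>

lemma poly_cheb_joukowsky: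
  assumes "u \<noteq> 0"
  shows "poly (cheb k) ((u + 1 / u) / 2) = (u ^ k + 1 / u ^ k) / 2"
proof (induction k rule: cheb.induct)
  case (3 n)
  define v where "v = 1 / u"
  have uv: "u * v = 1" using assms by (simp add: v_def)
  have "(u + v) * (u ^ Suc n + v ^ Suc n) = u ^ Suc (Suc n) + v ^ Suc (Suc n) + (u * v) * (u ^ n + v ^ n)"
    by (simp add: algebra_simps)
  moreover have "poly (cheb (Suc (Suc n))) ((u + v) / 2) =
      (u + v) * poly (cheb (Suc n)) ((u + v) / 2) - poly (cheb n) ((u + v) / 2)"
    by simp
  ultimately show ?case
    using 3 uv unfolding power_one_over[symmetric] v_def[symmetric] by (simp del: power_Suc cheb.simps) (simp add: field_simps del: power_Suc)
qed auto

lemma cmod_poly_cheb_le: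
  assumes "x \<in> {-1..1}"
  shows "cmod (poly (cheb k) (of_real x)) \<le> 1"
proof -
  define u where "u = cis (arccos x)"
  have x: "x = cos (arccos x)" using assms by simp
  have "1 / u = cnj u" by (simp add: u_def cis_cnj cis_divide[of 0, simplified] flip: cis_inverse)
  then have "complex_of_real x = (u + 1 / u) / 2"
    using x by (simp add: u_def complex_eq_iff)
  moreover have "u \<noteq> 0" by (simp add: u_def)
  ultimately have "poly (cheb k) (of_real x) = (u ^ k + 1 / u ^ k) / 2"
    by (simp only: poly_cheb_joukowsky[OF \<open>u \<noteq> 0\<close>])
  also have "cmod \<dots> \<le> (cmod (u ^ k) + cmod (1 / u ^ k)) / 2"
    using norm_triangle_ineq[of "u ^ k" "1 / u ^ k"] by (simp add: norm_divide)
  also have "\<dots> = 1" by (simp add: u_def norm_power norm_divide)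
  finally show ?thesis .
qed

lemma poly_cheb_minus: "poly (cheb k) (- z) = (- 1) ^ k * poly (cheb k) z"
  by (induction k rule: cheb.induct) (auto simp: algebra_simps)

lemma degree_cheb_le: "degree (cheb k) \<le> k"
proof (induction k rule: cheb.induct)
  case (3 n)
  have "degree ([:0, 2:] * cheb (Suc n)) \<le> Suc (Suc n)"
    using degree_mult_le[of "[:0, 2:]" "cheb (Suc n)"] 3 by simp
  then show ?case using 3 by (auto intro!: degree_diff_le)
qed auto

lemma coeff_cheb_nonzero: "coeff (cheb k) k \<noteq> 0"
proof (induction k rule: cheb.induct)
  case (3 n)
  have "coeff (cheb n) (Suc (Suc n)) = 0"
    using degree_cheb_le[of n] by (intro coeff_eq_0) simp
  then show ?case using 3 by simp
qed auto

lemma poly_cheb_eq_chebU: "poly (cheb (Suc k)) x = poly (chebU (Suc k)) x - x * poly (chebU k) x"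
proof (induction k rule: chebU.induct)
  case (3 n)
  have "poly (cheb (Suc (Suc (Suc n)))) x = 2 * x * poly (cheb (Suc (Suc n))) x - poly (cheb (Suc n)) x"
    by (simp only: cheb.simps(3)[of "Suc n"]) simp
  also have "\<dots> = poly (chebU (Suc (Suc (Suc n)))) x - x * poly (chebU (Suc (Suc n))) x"
    unfolding 3 by (simp add: algebra_simps)
  finally show ?case .
qed (simp_all add: algebra_simps)

lemma cheb_eq_chebU: "smult 2 (cheb (Suc (Suc k))) = chebU (Suc (Suc k)) - chebU k"
proof -
  have "poly (smult 2 (cheb (Suc (Suc k)))) x = poly (chebU (Suc (Suc k)) - chebU k) x" for x
    unfolding poly_smult poly_cheb_eq_chebU by (simp add: algebra_simps)
  then show ?thesis by (simp only: poly_eq_poly_eq_iff[symmetric] fun_eq_iff) blast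
qed

lemma pderiv_cheb: "pderiv (cheb (Suc k)) = smult (of_nat (Suc k)) (chebU k)"
proof (induction k rule: chebU.induct)
  case 1 then show ?case by (simp add: pderiv_pCons)
next
  case 2 then show ?case by (simp add: pderiv_pCons pderiv_diff)
next
  case (3 n)
  have "pderiv (cheb (Suc (Suc (Suc n)))) = smult 2 (cheb (Suc (Suc n))) +
      [:0, 2:] * pderiv (cheb (Suc (Suc n))) - pderiv (cheb (Suc n))"
    by (simp only: cheb.simps(3) pderiv_diff pderiv_mult) (simp add: pderiv_pCons)
  also have "\<dots> = smult (of_nat (Suc (Suc (Suc n)))) (chebU (Suc (Suc n)))"
    unfolding cheb_eq_chebU 3 by (auto simp: poly_eq_poly_eq_iff[symmetric] algebra_simps fun_eq_iff)
  finally show ?case .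
qed

lemma has_integral_poly_complex:
  fixes p :: "complex poly"
  assumes "a \<le> b"
  shows "((\<lambda>x. poly (pderiv p) (of_real x)) has_integral (poly p (of_real b) - poly p (of_real a))) {a..b}"
proof (rule fundamental_theorem_of_calculus[OF assms])
  fix x
  have "((poly p) has_field_derivative poly (pderiv p) (of_real x)) (at (of_real x))"
    by (rule poly_DERIV)
  from has_vector_derivative_real_field[OF this]
  show "((\<lambda>x. poly p (of_real x)) has_vector_derivative poly (pderiv p) (of_real x)) (at x within {a..b})"
    by (rule has_vector_derivative_at_within)
qed

lemma cmod_integral_cheb_le:
  assumes "k \<ge> 2"
  shows "cmod (integral {-1..1} (\<lambda>x. poly (cheb k) (of_real x))) \<le> 4 / 3"
proof -
  obtain m where k: "k = Suc (Suc m)" using assms by (metis Suc_le_D numeral_2_eq_2 Suc_le_mono)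
  \<comment> \<open>The antiderivative T_(k+1)/(2(k+1)) - T_(k-1)/(2(k-1)) of T_k. As
    \<open>k \<ge> 2\<close>, the factors are at most 1/6 and 1/2, giving at most 2/3 at each
    endpoint.\<close>
  define F where "F = smult (1 / (2 * of_nat (Suc (Suc (Suc m))))) (cheb (Suc (Suc (Suc m)))) - smult (1 / (2 * of_nat (Suc m))) (cheb (Suc m))"
  have "smult 2 (pderiv F) = chebU (Suc (Suc m)) - chebU m"
    unfolding F_def pderiv_diff pderiv_smult pderiv_cheb by (simp del: chebU.simps of_nat_Suc add: smult_diff_right)
  also have "\<dots> = smult 2 (cheb k)"
    unfolding k by (simp only: cheb_eq_chebU)
  finally have "smult (1 / 2) (smult 2 (pderiv F)) = smult (1 / 2) (smult 2 (cheb k))"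
    by (rule arg_cong)
  then have F: "pderiv F = cheb k" by (simp only: smult_smult) simp
  have b: "cmod (poly F (of_real x)) \<le> 2 / 3" if "x \<in> {-1..1}" for x
  proof -
    have "cmod (poly F (of_real x)) \<le> cmod (1 / (2 * of_nat (Suc (Suc (Suc m)))) * poly (cheb (Suc (Suc (Suc m)))) (of_real x)) +
        cmod (1 / (2 * of_nat (Suc m)) * poly (cheb (Suc m)) (of_real x))"
      unfolding F_def poly_diff poly_smult by (rule norm_triangle_ineq4)
    also have "\<dots> \<le> 1 / 6 * 1 + 1 / 2 * 1"
      unfolding norm_mult
    proof (intro add_mono mult_mono)
      show "cmod (1 / (2 * of_nat (Suc (Suc (Suc m))))) \<le> 1 / 6" "cmod (1 / (2 * of_nat (Suc m))) \<le> 1 / 2"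
        unfolding norm_divide norm_mult norm_of_nat norm_one norm_numeral by (simp_all add: divide_simps)
    qed (auto intro: cmod_poly_cheb_le[OF that] simp del: cheb.simps)
    finally show ?thesis by simp
  qed
  have "integral {-1..1} (\<lambda>x. poly (cheb k) (of_real x)) = poly F (of_real 1) - poly F (of_real (- 1))"
    using has_integral_poly_complex[of "- 1" 1 F] unfolding F by (intro integral_unique) simp
  also have "cmod \<dots> \<le> cmod (poly F (of_real 1)) + cmod (poly F (of_real (- 1)))"
    by (rule norm_triangle_ineq4)
  also have "\<dots> \<le> 4 / 3" using b[of 1] b[of "- 1"] by simp
  finally show ?thesis .
qed

section \<open>Size of Chebyshev coefficients\<close>

lemma poly_expand_in_basis:
  fixes Q :: "nat \<Rightarrow> 'a::field poly"
  assumes "\<And>k. degree (Q k) \<le> k" "\<And>k. coeff (Q k) k \<noteq> 0" "degree p \<le> n"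
  shows "\<exists>a. p = (\<Sum>k\<le>n. smult (a k) (Q k))"
  using assms(3)
proof (induction n arbitrary: p)
  case 0
  then obtain c where "p = [:c:]" by (auto elim: degree_eq_zeroE)
  moreover obtain d where d: "Q 0 = [:d:]" using assms(1)[of 0] by (auto elim: degree_eq_zeroE)
  moreover have "d \<noteq> 0" using assms(2)[of 0] d by simp
  ultimately show ?case by (intro exI[of _ "\<lambda>_. c / d"]) simp
next
  case (Suc n)
  define c where "c = coeff p (Suc n) / coeff (Q (Suc n)) (Suc n)"
  define q where "q = p - smult c (Q (Suc n))"
  have "degree q \<le> n"
  proof (rule degree_le, clarify)
    fix i assume "n < i"
    show "coeff q i = 0"
    proof (cases "i = Suc n")
      case True
      then show ?thesis using assms(2)[of "Suc n"] by (simp add: q_def c_def)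
    next
      case False
      then have "degree p < i" "degree (Q (Suc n)) < i"
        using Suc.prems assms(1)[of "Suc n"] \<open>n < i\<close> by auto
      then show ?thesis by (simp add: q_def coeff_eq_0)
    qed
  qed
  then obtain a where a: "q = (\<Sum>k\<le>n. smult (a k) (Q k))" using Suc.IH by blast
  have "p = (\<Sum>k\<le>Suc n. smult ((a(Suc n := c)) k) (Q k))"
    using a by (simp add: q_def algebra_simps)
  then show ?case by blast
qed

lemma coeff_higher_pderiv_0: "coeff ((pderiv ^^ n) p) 0 = fact n * coeff p n"
  by (induction n arbitrary: p) (simp_all add: funpow_Suc_right coeff_pderiv algebra_simps del: funpow.simps)

lemma coeff_Cauchy_bound:
  assumes "r > 0" and B: "\<And>u. cmod u = r \<Longrightarrow> cmod (poly q u) \<le> B"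
  shows "cmod (coeff q n) \<le> B / r ^ n"
proof -
  have deriv_poly: "deriv (poly p) = poly (pderiv p)" for p :: "complex poly"
    using poly_DERIV DERIV_imp_deriv by blast
  have "(deriv ^^ n) (poly p) = poly ((pderiv ^^ n) p)" for p :: "complex poly"
    by (induction n) (simp_all add: deriv_poly)
  then have "(deriv ^^ n) (poly q) 0 = fact n * coeff q n"
    by (simp add: poly_0_coeff_0 coeff_higher_pderiv_0)
  moreover have "cmod ((deriv ^^ n) (poly q) 0) \<le> fact n * B / r ^ n"
    using B \<open>r > 0\<close> by (intro Cauchy_inequality continuous_intros) (auto intro: holomorphic_intros)
  ultimately have "fact n * cmod (coeff q n) \<le> fact n * (B / r ^ n)"
    by (simp add: norm_mult)
  then show ?thesis by (simp only: mult_le_cancel_left_pos[OF fact_gt_zero])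
qed

text \<open>For \<open>p = \<Sum>a\<^sub>k T\<^sub>k\<close> of degree at most \<open>n\<close>, the function \<open>u\<^sup>n p((u + 1/u)/2)\<close> is a
  polynomial in \<open>u\<close> whose coefficient at \<open>u\<^bsup>n+k\<^esup>\<close> is \<open>a\<^sub>k / 2\<close>, so Cauchy's inequality on \<open>|u| = r\<close> applies.\<close>

lemma cheb_coeff_bound:
  assumes p: "p = (\<Sum>k\<le>n. smult (a k) (cheb k))" and "r > 0"
    and M: "\<And>u. cmod u = r \<Longrightarrow> cmod (poly p ((u + 1 / u) / 2)) \<le> M"
    and k: "1 \<le> k" "k \<le> n"
  shows "cmod (a k) \<le> 2 * M / r ^ k"
proof -
  define q where "q = (\<Sum>k\<le>n. smult (a k / 2) (monom 1 (n + k) + monom 1 (n - k)))"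
  have q: "poly q u = u ^ n * poly p ((u + 1 / u) / 2)" if "u \<noteq> 0" for u
    unfolding q_def p poly_sum sum_distrib_left
  proof (rule sum.cong[OF refl])
    fix k assume "k \<in> {..n}"
    then have "u ^ (n - k) = u ^ n / u ^ k" using that by (simp add: power_diff)
    then show "poly (smult (a k / 2) (monom 1 (n + k) + monom 1 (n - k))) u =
        u ^ n * poly (smult (a k) (cheb k)) ((u + 1 / u) / 2)"
      unfolding poly_smult poly_add poly_monom poly_cheb_joukowsky[OF that]
      using that by (simp add: power_add field_simps)
  qed
  \<comment> \<open>Since \<open>k \<ge> 1\<close>, the exponent \<open>n + k\<close> differs from
    every \<open>n - j\<close>; at \<open>k = 0\<close> both monomials of one summand would
    contribute.\<close>
  have "coeff q (n + k) = (\<Sum>j\<le>n. if j = k then a k / 2 else 0)"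
    unfolding q_def coeff_sum using k(1) by (intro sum.cong) auto
  then have "coeff q (n + k) = a k / 2" using k by simp
  then have "a k = 2 * coeff q (n + k)" by (simp only:) simp
  then have "cmod (a k) = 2 * cmod (coeff q (n + k))" by (simp only: norm_mult norm_numeral)
  moreover have "cmod (coeff q (n + k)) \<le> (r ^ n * M) / r ^ (n + k)"
  proof (rule coeff_Cauchy_bound[OF \<open>r > 0\<close>])
    fix u :: complex assume u: "cmod u = r"
    then have "u \<noteq> 0" using \<open>r > 0\<close> by auto
    then show "cmod (poly q u) \<le> r ^ n * M"
      using M[OF u] u \<open>r > 0\<close> by (simp add: q norm_mult norm_power)
  qed
  moreover have "(r ^ n * M) / r ^ (n + k) = M / r ^ k"
    using \<open>r > 0\<close> by (simp add: power_add)
  ultimately show ?thesis by simp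
qed

section \<open>Symmetry and positivity of the Gauss--Legendre rule\<close>

lemma poly_legendre_minus: "poly (legendre n) (- x) = (- 1) ^ n * poly (legendre n) x"
  by (induction n rule: legendre.induct) (auto simp: field_simps)

text \<open>Parity of the Legendre polynomial makes the set of nodes symmetric. As the nodes come in
  no particular order, the symmetry is a permutation of the indices.\<close>

lemma gauss_legendre_reflection:
  assumes "gauss_legendre J s w"
  obtains \<sigma> where "bij_betw \<sigma> {..<J} {..<J}" "\<And>j. j < J \<Longrightarrow> s (\<sigma> j) = - s j"
proof -
  have roots: "s ` {..<J} = {x. poly (legendre J) x = 0}" and inj: "inj_on s {..<J}"
    using assms by (auto simp: gauss_legendre_def)
  have "\<exists>i<J. s i = - s j" if "j < J" for j
  proof -
    have "poly (legendre J) (s j) = 0" using roots that by blast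
    then have "- s j \<in> s ` {..<J}" unfolding roots by (simp add: poly_legendre_minus)
    then show ?thesis by (metis imageE lessThan_iff)
  qed
  then obtain \<sigma> where \<sigma>: "\<And>j. j < J \<Longrightarrow> \<sigma> j < J \<and> s (\<sigma> j) = - s j" by metis
  have inv: "\<sigma> (\<sigma> j) = j" if "j < J" for j
    using \<sigma>[OF that] \<sigma>[of "\<sigma> j"] that inj by (auto simp: inj_on_def)
  have "bij_betw \<sigma> {..<J} {..<J}"
    by (rule bij_betwI[where g=\<sigma>]) (use \<sigma> inv in auto)
  with \<sigma> show ?thesis using that by blast
qed

lemma gauss_legendre_sum_nodes:
  assumes "gauss_legendre J s w"
  shows "(\<Sum>j<J. s j) = 0"
proof -
  obtain \<sigma> where \<sigma>: "bij_betw \<sigma> {..<J} {..<J}" "\<And>j. j < J \<Longrightarrow> s (\<sigma> j) = - s j"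
    using gauss_legendre_reflection[OF assms] by blast
  have "(\<Sum>j<J. s j) = (\<Sum>j<J. s (\<sigma> j))" using sum.reindex_bij_betw[OF \<sigma>(1)] by metis
  also have "\<dots> = - (\<Sum>j<J. s j)" using \<sigma>(2) by (simp add: sum_negf)
  finally show ?thesis by simp
qed

text \<open>Exactness on \<open>\<Prod>\<^bsub>i\<noteq>j\<^esub> (X - s\<^sub>i)\<^sup>2\<close>, which isolates the weight \<open>w\<^sub>j\<close>.\<close>

lemma gauss_legendre_weight:
  assumes "gauss_legendre J s w" "j < J"
  shows "w j * (\<Prod>i\<in>{..<J} - {j}. (s j - s i)\<^sup>2) = integral {-1..1} (\<lambda>x. \<Prod>i\<in>{..<J} - {j}. (x - s i)\<^sup>2)"
    and "(\<Prod>i\<in>{..<J} - {j}. (s j - s i)\<^sup>2) > 0"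
proof -
  define p where "p = (\<Prod>i\<in>{..<J} - {j}. [:- s i, 1:]\<^sup>2)"
  have p: "poly p x = (\<Prod>i\<in>{..<J} - {j}. (x - s i)\<^sup>2)" for x
    by (simp add: p_def poly_prod poly_power)
  have "degree p \<le> (\<Sum>i\<in>{..<J} - {j}. degree ([:- s i, 1:]\<^sup>2))"
    unfolding p_def using degree_prod_sum_le[of "{..<J} - {j}" "\<lambda>i. [:- s i, 1:]\<^sup>2"] by (simp add: o_def)
  also have "\<dots> \<le> (\<Sum>i\<in>{..<J} - {j}. 2)"
    by (intro sum_mono order_trans[OF degree_power_le]) simp
  also have "\<dots> < 2 * J" using assms(2) by simp
  finally have "(\<Sum>i<J. w i * poly p (s i)) = integral {-1..1} (poly p)"
    using assms(1) by (auto simp: gauss_legendre_def)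
  moreover have "(\<Sum>i<J. w i * poly p (s i)) = (\<Sum>i\<in>{j}. w i * poly p (s i))"
    using assms(2) by (intro sum.mono_neutral_right) (auto simp: p prod_zero_iff)
  ultimately show "w j * (\<Prod>i\<in>{..<J} - {j}. (s j - s i)\<^sup>2) = integral {-1..1} (\<lambda>x. \<Prod>i\<in>{..<J} - {j}. (x - s i)\<^sup>2)"
    by (simp add: p[symmetric])
  show "(\<Prod>i\<in>{..<J} - {j}. (s j - s i)\<^sup>2) > 0"
    using assms by (intro prod_pos) (auto simp: gauss_legendre_def inj_on_def)
qed

text \<open>A nonnegative integral equals \<open>w j\<close> times a positive number. With
  nonnegative weights the quadrature sum is controlled by the supremum of the integrand.\<close>

lemma gauss_legendre_weight_nonneg:
  assumes "gauss_legendre J s w" "j < J"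
  shows "w j \<ge> 0"
proof -
  have "integral {-1..1} (\<lambda>x. \<Prod>i\<in>{..<J} - {j}. (x - s i)\<^sup>2) \<ge> 0"
    by (intro integral_nonneg integrable_continuous_real continuous_intros prod_nonneg) auto
  then show ?thesis
    using gauss_legendre_weight[OF assms] by (metis mult_neg_pos not_le)
qed

text \<open>The substitution of -x for x carries the integral formula for the weight at
  \<open>\<sigma> j\<close> into the one at \<open>j\<close>.\<close>

lemma gauss_legendre_weight_reflection:
  assumes gl: "gauss_legendre J s w"
    and \<sigma>: "bij_betw \<sigma> {..<J} {..<J}" "\<And>j. j < J \<Longrightarrow> s (\<sigma> j) = - s j" and "j < J"
  shows "w (\<sigma> j) = w j"
proof -
  have \<sigma>j: "\<sigma> j < J" using \<sigma>(1) \<open>j < J\<close> by (auto simp: bij_betw_def)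
  have "bij_betw \<sigma> ({..<J} - {j}) ({..<J} - {\<sigma> j})"
    using \<sigma>(1) \<open>j < J\<close> unfolding bij_betw_def
    by (auto simp: inj_on_image_set_diff[of _ "{..<J}"] intro: inj_on_subset)
  then have refl_prod: "(\<Prod>i\<in>{..<J} - {\<sigma> j}. (x - s i)\<^sup>2) = (\<Prod>i\<in>{..<J} - {j}. (- x - s i)\<^sup>2)" for x
  proof -
    have "(\<Prod>i\<in>{..<J} - {\<sigma> j}. (x - s i)\<^sup>2) = (\<Prod>i\<in>{..<J} - {j}. (x - s (\<sigma> i))\<^sup>2)"
      by (rule prod.reindex_bij_betw[OF \<open>bij_betw \<sigma> ({..<J} - {j}) _\<close>, symmetric])
    also have "\<dots> = (\<Prod>i\<in>{..<J} - {j}. (- x - s i)\<^sup>2)"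
      using \<sigma>(2) by (intro prod.cong) (auto simp: power2_eq_square algebra_simps)
    finally show ?thesis .
  qed
  have "w (\<sigma> j) * (\<Prod>i\<in>{..<J} - {j}. (s j - s i)\<^sup>2) = integral {-1..1} (\<lambda>x. \<Prod>i\<in>{..<J} - {j}. (- x - s i)\<^sup>2)"
    using gauss_legendre_weight(1)[OF gl \<sigma>j] by (simp only: refl_prod \<sigma>(2)[OF \<open>j < J\<close>] minus_minus)
  also have "\<dots> = integral {-1..1} (\<lambda>x. \<Prod>i\<in>{..<J} - {j}. (x - s i)\<^sup>2)"
    using Henstock_Kurzweil_Integration.integral_reflect_real[of 1 "- 1" "\<lambda>x. \<Prod>i\<in>{..<J} - {j}. (x - s i)\<^sup>2"] by (simp only: minus_minus)
  also have "\<dots> = w j * (\<Prod>i\<in>{..<J} - {j}. (s j - s i)\<^sup>2)"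
    by (rule gauss_legendre_weight(1)[OF gl \<open>j < J\<close>, symmetric])
  finally show ?thesis using gauss_legendre_weight(2)[OF gl \<open>j < J\<close>] by (metis less_irrefl mult_right_cancel)
qed

section \<open>The quadrature error\<close>

definition gl_error :: "nat \<Rightarrow> (nat \<Rightarrow> real) \<Rightarrow> (nat \<Rightarrow> real) \<Rightarrow> (real \<Rightarrow> complex) \<Rightarrow> complex" where
  "gl_error J s w f = integral {-1..1} f - (\<Sum>j<J. of_real (w j) * f (s j))"

lemma gl_error_diff:
  assumes "continuous_on {-1..1} f" "continuous_on {-1..1} g"
  shows "gl_error J s w (\<lambda>x. f x - g x) = gl_error J s w f - gl_error J s w g"
  unfolding gl_error_def
  by (subst integral_diff) (use assms in \<open>auto intro: integrable_continuous_real simp: algebra_simps sum_subtractf\<close>)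

lemma gl_error_linear_combination:
  assumes "finite I" "\<And>k. k \<in> I \<Longrightarrow> continuous_on {-1..1} (f k)"
  shows "gl_error J s w (\<lambda>x. \<Sum>k\<in>I. a k * f k x) = (\<Sum>k\<in>I. a k * gl_error J s w (f k))"
proof -
  have "integral {-1..1} (\<lambda>x. \<Sum>k\<in>I. a k * f k x) = (\<Sum>k\<in>I. a k * integral {-1..1} (f k))"
    using assms by (subst integral_sum) (auto intro!: integrable_continuous_real continuous_intros)
  moreover have "(\<Sum>j<J. of_real (w j) * (\<Sum>k\<in>I. a k * f k (s j))) = (\<Sum>k\<in>I. a k * (\<Sum>j<J. of_real (w j) * f k (s j)))"
    unfolding sum_distrib_left by (subst sum.swap) (simp add: mult_ac)
  ultimately show ?thesis
    by (simp add: gl_error_def sum_subtractf right_diff_distrib)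
qed

text \<open>Exactness is given for real polynomials only, so the coefficients are split into real
  and imaginary parts.\<close>

lemma gl_error_poly_eq_0:
  assumes gl: "gauss_legendre J s w" and "degree p < 2 * J"
  shows "gl_error J s w (\<lambda>x. poly p (of_real x)) = 0"
proof -
  have split: "poly q (of_real x) = of_real (poly (map_poly Re q) x) + \<i> * of_real (poly (map_poly Im q) x)" for q x
    by (induction q) (simp_all add: map_poly_pCons complex_eq_iff)
  have ex: "(\<Sum>j<J. w j * poly q (s j)) = integral {-1..1} (poly q)" if "degree q < 2 * J" for q :: "real poly"
    using gl that by (simp add: gauss_legendre_def)
  have deg: "degree (map_poly Re p) < 2 * J" "degree (map_poly Im p) < 2 * J"
    using assms(2) map_poly_degree_leq[of Re p] map_poly_degree_leq[of Im p] by auto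
  have int: "((\<lambda>x. poly q x) has_integral integral {-1..1} (poly q)) {-1..1}" for q :: "real poly"
    by (intro integrable_integral integrable_continuous_real continuous_intros)
  have "((\<lambda>x. poly p (of_real x)) has_integral (of_real (integral {-1..1} (poly (map_poly Re p))) +
      \<i> * of_real (integral {-1..1} (poly (map_poly Im p))))) {-1..1}"
    unfolding split by (intro has_integral_add has_integral_mult_right has_integral_of_real int)
  moreover have "(\<Sum>j<J. of_real (w j) * poly p (of_real (s j))) =
      of_real (\<Sum>j<J. w j * poly (map_poly Re p) (s j)) + \<i> * of_real (\<Sum>j<J. w j * poly (map_poly Im p) (s j))"
    unfolding split by (simp add: algebra_simps sum.distrib sum_distrib_left)
  ultimately show ?thesis
    unfolding gl_error_def using ex[OF deg(1)] ex[OF deg(2)] by (simp add: integral_unique)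
qed

lemma gl_error_odd:
  assumes gl: "gauss_legendre J s w" and odd: "\<And>x. f (- x) = - f x"
  shows "gl_error J s w f = 0"
proof -
  obtain \<sigma> where \<sigma>: "bij_betw \<sigma> {..<J} {..<J}" "\<And>j. j < J \<Longrightarrow> s (\<sigma> j) = - s j"
    using gauss_legendre_reflection[OF gl] by blast
  have "(\<Sum>j<J. of_real (w j) * f (s j)) = (\<Sum>j<J. of_real (w (\<sigma> j)) * f (s (\<sigma> j)))"
    using sum.reindex_bij_betw[OF \<sigma>(1), of "\<lambda>j. of_real (w j) * f (s j)"] by simp
  also have "\<dots> = - (\<Sum>j<J. of_real (w j) * f (s j))"
    using \<sigma>(2) gauss_legendre_weight_reflection[OF gl \<sigma>] odd by (simp add: sum_negf)
  finally have "(\<Sum>j<J. of_real (w j) * f (s j)) = 0" by simp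
  moreover have "integral {-1..1} f = - integral {-1..1} f"
  proof -
    have "integral {-1..1} f = integral {-1..- (- 1)} (\<lambda>x. f (- x))"
      by (rule Henstock_Kurzweil_Integration.integral_reflect_real[symmetric])
    also have "\<dots> = - integral {-1..1} f"
      by (simp only: odd integral_neg minus_minus)
    finally show ?thesis .
  qed
  ultimately show ?thesis by (simp add: gl_error_def)
qed

lemma cmod_quadrature_sum_le:
  assumes gl: "gauss_legendre J s w" and "J \<ge> 1" and B: "\<And>x. x \<in> {-1..1} \<Longrightarrow> cmod (f x) \<le> B"
  shows "cmod (\<Sum>j<J. of_real (w j) * f (s j)) \<le> 2 * B"
proof -
  have "degree (1 :: real poly) < 2 * J" using \<open>J \<ge> 1\<close> by simp
  then have "(\<Sum>j<J. w j * poly 1 (s j)) = integral {-1..1} (\<lambda>x. poly 1 x)"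
    using gl unfolding gauss_legendre_def by blast
  then have sum_w: "(\<Sum>j<J. w j) = 2" by simp
  have "cmod (\<Sum>j<J. of_real (w j) * f (s j)) \<le> (\<Sum>j<J. w j * B)"
    using B gl gauss_legendre_weight_nonneg[OF gl]
    by (intro sum_norm_le) (auto simp: norm_mult gauss_legendre_def intro!: mult_left_mono)
  also have "\<dots> = 2 * B" by (simp add: sum_w flip: sum_distrib_right)
  finally show ?thesis .
qed

lemma cmod_gl_error_le:
  assumes gl: "gauss_legendre J s w" and "J \<ge> 1" and cont: "continuous_on {-1..1} f"
    and B: "\<And>x. x \<in> {-1..1} \<Longrightarrow> cmod (f x) \<le> B"
  shows "cmod (gl_error J s w f) \<le> 4 * B"
proof -
  have "cmod (integral {-1..1} f) \<le> B * (1 - - 1)"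
    using cont B by (intro integral_bound) auto
  moreover have "cmod (\<Sum>j<J. of_real (w j) * f (s j)) \<le> 2 * B"
    using assms by (intro cmod_quadrature_sum_le) auto
  ultimately show ?thesis
    unfolding gl_error_def by (intro order_trans[OF norm_triangle_ineq4]) simp
qed

text \<open>The constant is 2 for the sum plus 4/3 for the integral. The general factor 4 of
  \<open>cmod_gl_error_le\<close> would bring the total to exactly \<open>\<epsilon>\<close>; this
  saving makes the final inequality strict.\<close>

lemma cmod_gl_error_cheb_le:
  assumes gl: "gauss_legendre J s w" and "J \<ge> 1" and "k \<ge> 2"
  shows "cmod (gl_error J s w (\<lambda>x. poly (cheb k) (of_real x))) \<le> 10 / 3"
proof -
  have "cmod (\<Sum>j<J. of_real (w j) * poly (cheb k) (of_real (s j))) \<le> 2 * 1"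
    using cmod_poly_cheb_le by (intro cmod_quadrature_sum_le[OF gl \<open>J \<ge> 1\<close>]) 
  then show ?thesis
    unfolding gl_error_def using cmod_integral_cheb_le[OF \<open>k \<ge> 2\<close>]
    by (intro order_trans[OF norm_triangle_ineq4]) simp
qed

text \<open>The subtracted term is the remaining geometric tail; it strengthens the claim enough for
  induction.\<close>

lemma sum_half_powers_le: "(\<Sum>m\<le>N. if m \<ge> J then 1 / 2 ^ m else 0) \<le> 2 / 2 ^ J - (if N \<ge> J then 1 / 2 ^ N else 0 :: real)"
  by (induction N) (auto simp: not_less_eq_eq le_Suc_eq)

text \<open>Only the \<open>T\<^sub>k\<close> with \<open>k \<ge> 2J\<close> even contribute: the rule is exact below degree \<open>2J\<close> and
  integrates odd functions exactly by symmetry.\<close>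

lemma gl_error_poly_bound:
  assumes gl: "gauss_legendre J s w" and "J \<ge> 1"
    and M: "\<And>u. cmod u = sqrt 2 \<Longrightarrow> cmod (poly p ((u + 1 / u) / 2)) \<le> M"
  shows "cmod (gl_error J s w (\<lambda>x. poly p (of_real x))) \<le> 40 / 3 * M / 2 ^ J"
proof -
  let ?E = "gl_error J s w" and ?T = "\<lambda>k x. poly (cheb k) (complex_of_real x)"
  define N where "N = degree p"
  \<comment> \<open>The odd upper index \<open>Suc (2 * N)\<close> lets the terms be paired as
    \<open>2 * m\<close> and \<open>Suc (2 * m)\<close> with \<open>m \<le> N\<close>.\<close>
  obtain a where a: "p = (\<Sum>k\<le>Suc (2 * N). smult (a k) (cheb k))"
    using poly_expand_in_basis[of cheb p "Suc (2 * N)"] degree_cheb_le coeff_cheb_nonzero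
    unfolding N_def by fastforce
  have "M \<ge> 0" using M[of "of_real (sqrt 2)"] order_trans[OF norm_ge_zero] by force
  define h where "h k = cmod (a k * ?E (?T k))" for k
  \<comment> \<open>The factor 20/3 is 2 from the coefficient bound times 10/3, and the radius
    \<open>sqrt 2\<close> raised to \<open>2 * m\<close> is \<open>2 ^ m\<close>.\<close>
  have h_even: "h (2 * m) \<le> 20 / 3 * M * (if m \<ge> J then 1 / 2 ^ m else 0)" if "m \<le> N" for m
  proof (cases "m \<ge> J")
    case False
    then have "?E (?T (2 * m)) = 0"
      using degree_cheb_le[of "2 * m"] by (intro gl_error_poly_eq_0[OF gl]) simp
    then show ?thesis using False by (simp add: h_def)
  next
    case True
    have "cmod (a (2 * m)) \<le> 2 * M / sqrt 2 ^ (2 * m)"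
      using M True \<open>J \<ge> 1\<close> that by (intro cheb_coeff_bound[OF a]) auto
    then have "cmod (a (2 * m)) \<le> 2 * M / 2 ^ m" by (simp add: power_mult)
    moreover have "cmod (?E (?T (2 * m))) \<le> 10 / 3"
      using True \<open>J \<ge> 1\<close> by (intro cmod_gl_error_cheb_le[OF gl]) auto
    ultimately have "h (2 * m) \<le> 2 * M / 2 ^ m * (10 / 3)"
      unfolding h_def norm_mult using \<open>M \<ge> 0\<close> by (intro mult_mono) auto
    then show ?thesis using True by simp
  qed
  have h_odd: "h (Suc (2 * m)) = 0" for m
  proof -
    have "?E (?T (Suc (2 * m))) = 0"
      by (rule gl_error_odd[OF gl]) (simp only: of_real_minus poly_cheb_minus, simp)
    then show ?thesis by (simp add: h_def)
  qed
  have "?E (\<lambda>x. poly p (of_real x)) = (\<Sum>k\<le>Suc (2 * N). a k * ?E (?T k))"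
    unfolding a poly_sum poly_smult
    by (rule gl_error_linear_combination) (auto intro!: continuous_intros)
  then have "cmod (?E (\<lambda>x. poly p (of_real x))) \<le> (\<Sum>k\<le>Suc (2 * N). h k)"
    unfolding h_def by (simp only: norm_sum)
  also have "\<dots> = (\<Sum>m\<le>N. h (2 * m) + h (Suc (2 * m)))"
    by (simp only: sum.in_pairs_0)
  also have "\<dots> \<le> (\<Sum>m\<le>N. 20 / 3 * M * (if m \<ge> J then 1 / 2 ^ m else 0))"
    using h_even h_odd by (intro sum_mono) simp
  also have "\<dots> = 20 / 3 * M * (\<Sum>m\<le>N. if m \<ge> J then 1 / 2 ^ m else 0)"
    by (simp only: sum_distrib_left)
  also have "\<dots> \<le> 20 / 3 * M * (2 / 2 ^ J)"
  proof (rule mult_left_mono)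
    have "(if N \<ge> J then 1 / 2 ^ N else 0 :: real) \<ge> 0" by simp
    with sum_half_powers_le[of J N] show "(\<Sum>m\<le>N. if m \<ge> J then 1 / 2 ^ m else 0) \<le> (2 / 2 ^ J :: real)"
      by linarith
  qed (use \<open>M \<ge> 0\<close> in simp)
  finally show ?thesis by simp
qed

section \<open>The error for a single eigenvalue\<close>

text \<open>On this circle \<open>1 / u\<close> is half the conjugate of \<open>u\<close>, so the
  image is an ellipse with semi-axes 3/4 and 1/4 of \<open>sqrt 2\<close>. The crude bound 2
  supplies a disc for uniform Taylor approximation.\<close>

lemma cmod_joukowsky_le:
  assumes "cmod u = sqrt 2"
  shows "(u + 1 / u) / 2 = Complex (3 * Re u / 4) (Im u / 4)" "cmod ((u + 1 / u) / 2) \<le> 2"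
proof -
  have "u * cnj u = 2" using assms by (simp add: complex_norm_square[symmetric])
  moreover have "u \<noteq> 0" using assms by auto
  ultimately have inv: "1 / u = cnj u / 2" by (simp add: field_simps)
  show "(u + 1 / u) / 2 = Complex (3 * Re u / 4) (Im u / 4)"
    unfolding inv by (simp add: complex_eq_iff)
  have "cmod ((u + 1 / u) / 2) \<le> (cmod u + cmod (1 / u)) / 2"
    using norm_triangle_ineq[of u "1 / u"] by (simp add: norm_divide)
  also have "\<dots> \<le> 2"
    unfolding inv using assms sqrt2_less_2 by (simp add: norm_divide)
  finally show "cmod ((u + 1 / u) / 2) \<le> 2" .
qed

text \<open>Passing to the limit in the bound for the Taylor polynomials.\<close>

lemma gl_error_exp_bound:
  fixes \<kappa> :: complex
  assumes gl: "gauss_legendre J s w" and "J \<ge> 1"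
    and M: "\<And>u. cmod u = sqrt 2 \<Longrightarrow> cmod (exp (\<kappa> * (1 + (u + 1 / u) / 2))) \<le> M"
  shows "cmod (gl_error J s w (\<lambda>x. exp (\<kappa> * (1 + of_real x)))) \<le> 40 / 3 * M / 2 ^ J"
proof -
  let ?f = "\<lambda>z. exp (\<kappa> * (1 + z))"
  define p where "p n = smult (exp \<kappa>) (\<Sum>i\<le>n. monom (\<kappa> ^ i / fact i) i)" for n
  \<comment> \<open>A Taylor remainder bound on the disc of radius 2, which contains both the
    interval and the ellipse.\<close>
  define \<delta> where "\<delta> n = exp (cmod \<kappa>) * (exp (2 * cmod \<kappa>) * (2 * cmod \<kappa>) ^ Suc n / fact n)" for n
  have approx: "cmod (?f z - poly (p n) z) \<le> \<delta> n" if "cmod z \<le> 2" for z n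
  proof -
    have \<kappa>z: "cmod (\<kappa> * z) \<le> 2 * cmod \<kappa>"
      using mult_left_mono[OF that norm_ge_zero[of \<kappa>]] by (simp add: norm_mult mult.commute)
    have "?f z - poly (p n) z = exp \<kappa> * (exp (\<kappa> * z) - (\<Sum>i\<le>n. (\<kappa> * z) ^ i / fact i))"
      by (simp add: p_def poly_sum poly_monom exp_add algebra_simps power_mult_distrib)
    then have "cmod (?f z - poly (p n) z) = cmod (exp \<kappa>) * cmod (exp (\<kappa> * z) - (\<Sum>i\<le>n. (\<kappa> * z) ^ i / fact i))"
      by (simp only: norm_mult)
    also have "\<dots> \<le> exp (cmod \<kappa>) * (exp (cmod (\<kappa> * z)) * cmod (\<kappa> * z) ^ Suc n / fact n)"
      by (intro mult_mono norm_exp Taylor_exp_field) auto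
    also have "\<dots> \<le> \<delta> n"
      unfolding \<delta>_def using \<kappa>z
      by (intro mult_left_mono divide_right_mono mult_mono power_mono) auto
    finally show ?thesis .
  qed
  have bound: "cmod (gl_error J s w (\<lambda>x. ?f (of_real x))) \<le> 40 / 3 * (M + \<delta> n) / 2 ^ J + 4 * \<delta> n" for n
  proof -
    have "gl_error J s w (\<lambda>x. ?f (of_real x) - poly (p n) (of_real x)) =
        gl_error J s w (\<lambda>x. ?f (of_real x)) - gl_error J s w (\<lambda>x. poly (p n) (of_real x))"
      by (intro gl_error_diff continuous_intros)
    moreover have "cmod (gl_error J s w (\<lambda>x. ?f (of_real x) - poly (p n) (of_real x))) \<le> 4 * \<delta> n"
    proof (rule cmod_gl_error_le[OF gl \<open>J \<ge> 1\<close>])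
      show "cmod (?f (of_real x) - poly (p n) (of_real x)) \<le> \<delta> n" if "x \<in> {-1..1}" for x
        using that by (intro approx) (auto simp: abs_le_iff)
    qed (intro continuous_intros)
    moreover have "cmod (gl_error J s w (\<lambda>x. poly (p n) (of_real x))) \<le> 40 / 3 * (M + \<delta> n) / 2 ^ J"
    proof (rule gl_error_poly_bound[OF gl \<open>J \<ge> 1\<close>])
      fix u assume u: "cmod u = sqrt 2"
      let ?z = "(u + 1 / u) / 2"
      have "cmod (poly (p n) ?z) \<le> cmod (?f ?z) + cmod (?f ?z - poly (p n) ?z)"
        by (metis norm_minus_commute norm_triangle_sub)
      also have "\<dots> \<le> M + \<delta> n"
        using M[OF u] approx[OF cmod_joukowsky_le(2)[OF u]] by (rule add_mono)
      finally show "cmod (poly (p n) ?z) \<le> M + \<delta> n" .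
    qed
    ultimately show ?thesis
      using norm_triangle_sub[of "gl_error J s w (\<lambda>x. ?f (of_real x))" "gl_error J s w (\<lambda>x. poly (p n) (of_real x))"]
      by simp
  qed
  \<comment> \<open>Up to a constant factor, \<open>\<delta> n\<close> is a term of a convergent
    exponential series.\<close>
  have "(\<lambda>n. inverse (fact n) * (2 * cmod \<kappa>) ^ n) \<longlonglongrightarrow> 0"
    by (intro summable_LIMSEQ_zero summable_exp)
  then have "(\<lambda>n. exp (cmod \<kappa>) * (exp (2 * cmod \<kappa>) * (2 * cmod \<kappa>)) * (inverse (fact n) * (2 * cmod \<kappa>) ^ n)) \<longlonglongrightarrow> 0"
    by (rule tendsto_mult_right_zero)
  then have \<delta>: "\<delta> \<longlonglongrightarrow> 0"
    by (simp add: \<delta>_def[abs_def] divide_inverse mult_ac)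
  have "(\<lambda>n. 40 / 3 * (M + \<delta> n) / 2 ^ J + 4 * \<delta> n) \<longlonglongrightarrow> 40 / 3 * (M + 0) / 2 ^ J + 4 * 0"
    by (intro tendsto_intros \<delta>) auto
  then show ?thesis
    using bound by (intro LIMSEQ_le_const) auto
qed

lemma integral_exp_affine:
  fixes \<kappa> :: complex
  assumes "\<kappa> \<noteq> 0"
  shows "integral {-1..1} (\<lambda>x. exp (\<kappa> * (1 + of_real x))) = (exp (2 * \<kappa>) - 1) / \<kappa>"
proof -
  let ?F = "\<lambda>z. exp (\<kappa> * (1 + z)) / \<kappa>"
  have "((\<lambda>x. exp (\<kappa> * (1 + of_real x))) has_integral (?F (of_real 1) - ?F (of_real (- 1)))) {-1..1}"
  proof (rule fundamental_theorem_of_calculus)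
    fix x
    have "(?F has_field_derivative exp (\<kappa> * (1 + of_real x))) (at (of_real x))"
      using assms by (auto intro!: derivative_eq_intros)
    from has_vector_derivative_real_field[OF this]
    show "((\<lambda>x. ?F (of_real x)) has_vector_derivative exp (\<kappa> * (1 + of_real x))) (at x within {-1..1})"
      by (rule has_vector_derivative_at_within)
  qed simp
  then show ?thesis
    by (simp add: integral_unique diff_divide_distrib mult.commute)
qed

text \<open>With \<open>\<delta>\<close> = a - E and \<open>L\<close> = 2/(\<epsilon> b), the bound
  is 11/12 of \<epsilon>: truncation contributes \<open>1 / (b * L)\<close>, quadrature 5/6 of
  that.\<close>

lemma scalar_resolvent_error:
  fixes b \<delta> D L :: real
  defines "\<eta> \<equiv> (3 * b - 2 * sqrt 2 * b + D) / (4 * sqrt 2 * b)"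
  defines "T \<equiv> (1 / b) * ln L"
  defines "c \<equiv> \<i> * of_real \<delta> - of_real b"
  assumes gl: "gauss_legendre J s w" and "J \<ge> 1" and "b > 0" and "L > 1" and "\<bar>\<delta>\<bar> \<le> D"
    and J: "log 2 (ln L) + (\<eta> + 1) * log 2 L + 3 \<le> real J"
  shows "cmod (\<i> / c + \<i> * of_real (T / 2) * (\<Sum>j<J. of_real (w j) * exp (c * of_real (GL_time T s j))))
    \<le> 11 / 6 / (b * L)"
proof -
  have lnL: "ln L > 0" using \<open>L > 1\<close> by simp
  have "T > 0" using lnL \<open>b > 0\<close> by (simp add: T_def)
  have c: "Re c = - b" "c \<noteq> 0" using \<open>b > 0\<close> by (auto simp: c_def complex_eq_iff)
  define \<kappa> where "\<kappa> = c * of_real (T / 2)"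
  have "\<kappa> \<noteq> 0" using c \<open>T > 0\<close> by (simp add: \<kappa>_def)
  define M where "M = L powr \<eta>"
  have M: "cmod (exp (\<kappa> * (1 + (u + 1 / u) / 2))) \<le> M" if u: "cmod u = sqrt 2" for u
  proof -
    have x: "- Re u \<le> sqrt 2" and y: "\<bar>Im u\<bar> \<le> sqrt 2"
      using abs_Re_le_cmod[of u] abs_Im_le_cmod[of u] u by auto
    have "Re (\<kappa> * (1 + (u + 1 / u) / 2)) = T / 2 * (- b + 3 / 4 * b * (- Re u) + 1 / 4 * (- \<delta> * Im u))"
      unfolding cmod_joukowsky_le(1)[OF u] by (simp add: \<kappa>_def c_def algebra_simps)
    \<comment> \<open>The terms in \<open>Re u\<close> and \<open>Im u\<close> are maximised
      separately over the circle; the result is exactly \<open>\<eta> * ln L\<close>.\<close>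
    also have "\<dots> \<le> T / 2 * (- b + 3 / 4 * b * sqrt 2 + 1 / 4 * (D * sqrt 2))"
    proof -
      have "- \<delta> * Im u \<le> \<bar>\<delta>\<bar> * \<bar>Im u\<bar>" by (metis abs_ge_self abs_mult abs_minus_cancel)
      also have "\<dots> \<le> D * sqrt 2" using y \<open>\<bar>\<delta>\<bar> \<le> D\<close> by (intro mult_mono) auto
      finally show ?thesis
        using x \<open>b > 0\<close> \<open>T > 0\<close> by (intro mult_left_mono add_mono) auto
    qed
    also have "\<dots> = \<eta> * ln L"
    proof -
      have "1 / sqrt 2 = sqrt 2 / (2 :: real)" by (simp add: field_simps)
      then have "\<eta> = (3 * b - 2 * sqrt 2 * b + D) * (sqrt 2 / 2) / (4 * b)"
        unfolding \<eta>_def by (metis divide_divide_eq_left mult.assoc mult.commute times_divide_eq_right mult_1_right)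
      also have "\<dots> = (- b + 3 / 4 * b * sqrt 2 + 1 / 4 * (D * sqrt 2)) / (2 * b)"
        using \<open>b > 0\<close> by (simp add: field_simps)
      finally show ?thesis using \<open>b > 0\<close> by (simp add: T_def mult_ac)
    qed
    finally show ?thesis using \<open>L > 1\<close> by (simp add: M_def powr_def)
  qed
  define E where "E = gl_error J s w (\<lambda>x. exp (\<kappa> * (1 + of_real x)))"
  have E: "cmod E \<le> 40 / 3 * M / 2 ^ J"
    unfolding E_def by (rule gl_error_exp_bound[OF gl \<open>J \<ge> 1\<close> M])
  have "(\<Sum>j<J. of_real (w j) * exp (c * of_real (GL_time T s j))) = (exp (2 * \<kappa>) - 1) / \<kappa> - E"
    unfolding E_def gl_error_def integral_exp_affine[OF \<open>\<kappa> \<noteq> 0\<close>]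
    by (simp add: \<kappa>_def GL_time_def mult_ac)
  moreover have "\<i> * of_real (T / 2) * ((exp (2 * \<kappa>) - 1) / \<kappa>) = \<i> * (exp (c * of_real T) - 1) / c"
    using c \<open>T > 0\<close> by (simp add: \<kappa>_def field_simps)
  \<comment> \<open>The lower endpoint of the exact integral cancels \<open>\<i> / c\<close>,
    leaving the truncated tail and the quadrature error.\<close>
  ultimately have "\<i> / c + \<i> * of_real (T / 2) * (\<Sum>j<J. of_real (w j) * exp (c * of_real (GL_time T s j)))
      = \<i> * exp (c * of_real T) / c - \<i> * of_real (T / 2) * E"
    by (simp add: right_diff_distrib diff_divide_distrib)
  also have "cmod \<dots> \<le> cmod (\<i> * exp (c * of_real T) / c) + cmod (\<i> * of_real (T / 2) * E)"
    by (rule norm_triangle_ineq4)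
  also have "cmod (\<i> * exp (c * of_real T) / c) \<le> 1 / (b * L)"
  proof -
    have "exp (- b * T) = 1 / L"
      using \<open>b > 0\<close> \<open>L > 1\<close> by (simp add: T_def exp_minus field_simps)
    then have "cmod (\<i> * exp (c * of_real T) / c) = 1 / L / cmod c"
      using c by (simp add: norm_mult norm_divide)
    also have "\<dots> \<le> 1 / L / b"
      using abs_Re_le_cmod[of c] c \<open>b > 0\<close> \<open>L > 1\<close> by (intro divide_left_mono) auto
    finally show ?thesis by (simp add: mult.commute)
  qed
  also have "cmod (\<i> * of_real (T / 2) * E) \<le> 5 / 6 / (b * L)"
  proof -
    \<comment> \<open>Exponentiating the hypothesis on \<open>J\<close>: the three summands become
      \<open>ln L\<close>, \<open>L * M\<close> and 8.\<close>
    have "8 * ln L * (L * M) = 2 powr (log 2 (ln L) + (\<eta> + 1) * log 2 L + 3)"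
    proof -
      have "2 powr ((\<eta> + 1) * log 2 L) = L powr (\<eta> + 1)"
        using \<open>L > 1\<close> by (simp add: powr_powr[symmetric] mult.commute[of "\<eta> + 1"])
      moreover have "2 powr log 2 (ln L) = ln L" using lnL by simp
      ultimately show ?thesis
        using \<open>L > 1\<close> by (simp only: powr_add M_def) simp
    qed
    also have "\<dots> \<le> 2 powr real J" using J by (intro powr_mono) auto
    finally have P: "8 * ln L * (L * M) \<le> 2 ^ J" by (simp add: powr_realpow)
    have M0: "M > 0" using \<open>L > 1\<close> by (simp add: M_def)
    have "cmod (\<i> * of_real (T / 2) * E) = T / 2 * cmod E"
      using \<open>T > 0\<close> by (simp add: norm_mult)
    \<comment> \<open>Since \<open>T / 2\<close> is \<open>ln L / (2 * b)\<close>, the constant is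
      (40/3) / (2 * 8) = 5/6.\<close>
    also have "\<dots> \<le> T / 2 * (40 / 3 * M / (8 * ln L * (L * M)))"
    proof (intro mult_left_mono order_trans[OF E] divide_left_mono P)
      show "0 < 2 ^ J * (8 * ln L * (L * M))" using lnL M0 \<open>L > 1\<close> by simp
    qed (use M0 \<open>T > 0\<close> in auto)
    also have "\<dots> = 5 / 6 / (b * L)"
      using lnL M0 \<open>L > 1\<close> \<open>b > 0\<close> by (simp add: T_def field_simps)
    finally show ?thesis .
  qed
  finally show ?thesis by (simp add: mult_ac)
qed

section \<open>From single eigenvalues to the operator norm\<close>

lemma hermitian_has_eigenvalue:
  fixes H :: "complex^'n^'n"
  assumes "hermitian H"
  obtains l where "mat_eigenvalue H (of_real l)"
proof -
  obtain A v where "finite A" "(vec 1 :: complex^'n) = (\<Sum>l\<in>A. v l)"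
    and ev: "\<And>l. l \<in> A \<Longrightarrow> mat_eigenvalue H (of_real l)"
    using hermitian_decomposition[OF assms, of "vec 1"] by metis
  moreover have "(vec 1 :: complex^'n) \<noteq> 0" by (simp add: vec_eq_iff)
  ultimately have "A \<noteq> {}" by force
  then show ?thesis using ev that by blast
qed

theorem theorem1:
  fixes H :: "complex^'n^'n" and a b \<epsilon> :: real and s w :: "nat \<Rightarrow> real"
  assumes herm: "hermitian H"
    and b_pos: "b > 0"
    and eps_pos: "\<epsilon> > 0"
    and eps_small: "\<epsilon> * b < 2"
  defines "aplus \<equiv> Max {cmod (complex_of_real a - l) | l. mat_eigenvalue H l}"
  defines "\<eta> \<equiv> (3 * b - 2 * sqrt 2 * b + aplus) / (4 * sqrt 2 * b)"
  defines "L \<equiv> 2 / (\<epsilon> * b)"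
  defines "J \<equiv> nat \<lceil>log 2 (ln L) + (\<eta> + 1) * log 2 L + 3\<rceil>"
  defines "T \<equiv> (1 / b) * ln L"
  assumes GL: "gauss_legendre J s w"
  shows "opnorm2 (resolvent H (Complex a b) - GL_LCU H a b T J s w) < \<epsilon>
    \<and> (\<forall>j<J. \<bar>GL_time T s j\<bar> \<le> T)
    \<and> (\<Sum>j<J. \<bar>GL_time T s j\<bar>) = real J / (2 * b) * ln L"
proof (intro conjI)
  have "L > 1" using eps_small eps_pos b_pos by (simp add: L_def field_simps)
  then have "T > 0" using b_pos by (simp add: T_def)
  have nodes: "s j \<in> {-1..1}" if "j < J" for j
    using GL that by (simp add: gauss_legendre_def)
  have t: "0 \<le> GL_time T s j" "GL_time T s j \<le> T" if "j < J" for j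
  proof -
    show "0 \<le> GL_time T s j" using nodes[OF that] \<open>T > 0\<close> by (simp add: GL_time_def)
    have "T * (1 + s j) \<le> T * 2" using nodes[OF that] \<open>T > 0\<close> by (intro mult_left_mono) auto
    then show "GL_time T s j \<le> T" by (simp add: GL_time_def)
  qed
  then show "\<forall>j<J. \<bar>GL_time T s j\<bar> \<le> T" by simp
  \<comment> \<open>The times are nonnegative and affine in the nodes, whose sum vanishes by
    symmetry.\<close>
  have "(\<Sum>j<J. \<bar>GL_time T s j\<bar>) = (\<Sum>j<J. T / 2 + T / 2 * s j)"
    using t(1) by (intro sum.cong) (auto simp: GL_time_def field_simps)
  also have "\<dots> = real J * (T / 2)"
    by (simp only: sum.distrib sum_distrib_left[symmetric] gauss_legendre_sum_nodes[OF GL]) simp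
  finally show "(\<Sum>j<J. \<bar>GL_time T s j\<bar>) = real J / (2 * b) * ln L"
    by (simp add: T_def)

  define z where "z = Complex a b"
  \<comment> \<open>The scalar by which resolvent minus quadrature acts on the eigenspace of
    \<open>l\<close>; the plus sign comes from subtracting the prefactor \<open>- \<i>\<close> of
    \<open>GL_LCU\<close>.\<close>
  define F where "F l = 1 / (z - of_real l) + \<i> * of_real (T / 2) *
      (\<Sum>j<J. of_real (w j) * exp ((\<i> * of_real (a - l) - of_real b) * of_real (GL_time T s j)))" for l
  have action: "(resolvent H z - GL_LCU H a b T J s w) *v x = F l *s x"
    if x: "H *v x = of_real l *s x" for l x
  proof -
    have "GL_LCU H a b T J s w *v x = (- \<i> * of_real (T / 2) *
        (\<Sum>j<J. of_real (w j) * exp ((\<i> * of_real a - of_real b) * of_real (GL_time T s j)) *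
          exp (- \<i> * of_real (GL_time T s j) * of_real l))) *s x"
      unfolding GL_LCU_def cscale_mult_vec sum_matrix_vector_mult mexp_eigenvector[OF herm x] vector_smult_assoc
      by (simp only: vec.scale_sum_left[symmetric] vector_smult_assoc)
    also have "\<dots> = (- \<i> * of_real (T / 2) *
        (\<Sum>j<J. of_real (w j) * exp ((\<i> * of_real (a - l) - of_real b) * of_real (GL_time T s j)))) *s x"
      by (simp only: mult.assoc exp_add[symmetric]) (simp add: algebra_simps)
    finally show ?thesis
      using resolvent_eigenvector[OF herm _ x, of z] b_pos
      by (simp add: matrix_vector_mult_diff_rdistrib F_def z_def vector_sadd_rdistrib)
  qed
  let ?D = "{cmod (complex_of_real a - l) | l. mat_eigenvalue H l}"
  have "?D = (\<lambda>l. cmod (complex_of_real a - l)) ` {l. mat_eigenvalue H l}" by auto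
  then have "finite ?D" using hermitian_finite_eigenvalues[OF herm] by simp
  have dist: "\<bar>a - l\<bar> \<le> aplus" if "mat_eigenvalue H (of_real l)" for l
  proof -
    have "cmod (complex_of_real a - of_real l) \<le> aplus"
      unfolding aplus_def using \<open>finite ?D\<close> that by (intro Max_ge) auto
    then show ?thesis by (simp flip: of_real_diff)
  qed
  obtain l0 where "mat_eigenvalue H (of_real l0)" using hermitian_has_eigenvalue[OF herm] .
  then have "aplus \<ge> 0" using dist abs_ge_zero order_trans by blast
  \<comment> \<open>This makes \<open>3 * b - 2 * sqrt 2 * b\<close> nonnegative, hence also
    \<open>\<eta>\<close>.\<close>
  moreover have "sqrt 2 \<le> 3 / 2" by (rule real_le_lsqrt) (auto simp: power2_eq_square)
  ultimately have "\<eta> \<ge> 0" using b_pos by (simp add: \<eta>_def mult_right_mono)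
  have zl: "1 / (z - of_real l) = \<i> / (\<i> * of_real (a - l) - of_real b)" for l
  proof -
    have "\<i> * of_real (a - l) - of_real b = \<i> * (z - of_real l)" by (simp add: z_def complex_eq_iff)
    then show ?thesis by simp
  qed
  show "opnorm2 (resolvent H (Complex a b) - GL_LCU H a b T J s w) < \<epsilon>"
  \<comment> \<open>The quadrature estimates need at least one node, since exactness on constants
    does.\<close>
  proof (cases "J = 0")
    case False
    have "cmod (F l) \<le> 11 / 6 / (b * L)" if "mat_eigenvalue H (of_real l)" for l
      unfolding F_def zl T_def using False b_pos \<open>L > 1\<close> dist[OF that]
      by (intro scalar_resolvent_error[OF GL, where D=aplus]) (auto simp: J_def \<eta>_def)
    then have "opnorm2 (resolvent H z - GL_LCU H a b T J s w) \<le> 11 / 6 / (b * L)"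
      using action b_pos \<open>L > 1\<close> by (intro opnorm2_function_of_hermitian[OF herm]) auto
    also have "\<dots> < \<epsilon>" using eps_pos b_pos by (simp add: L_def field_simps)
    finally show ?thesis by (simp add: z_def)
  next
    case True
    txt \<open>The rule is empty here, which forces \<open>L < 2\<close>; then already \<open>\<parallel>R(z)\<parallel> \<le> 1/b < \<epsilon>\<close>.\<close>
    have "cmod (F l) \<le> 1 / b" for l
    proof -
      have "b \<le> cmod (z - of_real l)" using abs_Im_le_cmod[of "z - of_real l"] b_pos by (simp add: z_def)
      then show ?thesis using True b_pos by (simp add: F_def norm_divide frac_le)
    qed
    then have "opnorm2 (resolvent H z - GL_LCU H a b T J s w) \<le> 1 / b"
      using action b_pos by (intro opnorm2_function_of_hermitian[OF herm]) auto
    also have "1 / b < \<epsilon>"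
    proof (rule ccontr)
      assume "\<not> 1 / b < \<epsilon>"
      then have "L \<ge> 2" using eps_pos b_pos by (simp add: L_def field_simps)
      then have "ln 2 \<le> ln L" by simp
      \<comment> \<open>Thus the iterated logarithm is at least -1, which the summand 3 in
        \<open>J\<close> outweighs.\<close>
      then have "ln L \<ge> 1 / 2" using ln2_ge_two_thirds by linarith
      then have "log 2 (ln L) \<ge> log 2 (1 / 2)" by simp
      moreover have "log 2 (1 / 2) = (- 1 :: real)" by (simp add: log_divide)
      moreover have "log 2 L \<ge> 0" using \<open>L \<ge> 2\<close> by simp
      then have "(\<eta> + 1) * log 2 L \<ge> 0" using \<open>\<eta> \<ge> 0\<close> by simp
      ultimately have "log 2 (ln L) + (\<eta> + 1) * log 2 L + 3 > 0" by linarith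
      then have "J > 0" unfolding J_def zero_less_nat_eq zero_less_ceiling .
      with True show False by simp
    qed
    finally show ?thesis by (simp add: z_def)
  qed
qed

end
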